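(* Let $m\geq 3$ be an integer, let $\mathbb{K}$ be an infinite field with ${\rm char}(\mathbb{K})\nmid m$, and let $f=l_1\cdots l_m\in R=\mathbb{K}[x,y]$ be the defining polynomial of a central arrangement of rank $2$ and size $m$. Let $J_f=\langle f_x,f_y\rangle$ and $\mathbb{I}=\langle f/l_1,\ldots,f/l_m\rangle$. Then $J_f$ is a reduction of $\mathbb{I}$ with reduction number one.
   Context: A central arrangement of size $m$ is given by nonzero, pairwise non-proportional linear forms $l_1,\ldots,l_m\in R$; its rank is the dimension of their $\mathbb{K}$-span. An ideal $J\subset I$ is a reduction of $I$ if $I^{k+1}=JI^{k}$ for some $k\geq 0$; the least such $k$ is the reduction number of $I$ with respect to $J$. *)

theory Defs
  imports
    "HOL-Algebra.Algebraic_Closure_Type"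
    "HOL-Algebra.Ideal_Product"
    "HOL-Computational_Algebra.Polynomial"
begin

text \<open>
  The ring \<open>R = K[x,y]\<close> is rendered as the type \<open>'a poly poly = (K[x])[y]\<close>: the inner
  indeterminate is \<open>x\<close>, the outer one is \<open>y\<close>.  To use ideals and their products from
  HOL-Algebra, the type is viewed as a ring record by \<^const>\<open>ring_of_type_algebra\<close>.
\<close>

abbreviation Kxy :: "'a::field poly poly ring"
  where "Kxy \<equiv> ring_of_type_algebra"

definition scal :: "'a::field \<Rightarrow> 'a poly poly \<Rightarrow> 'a poly poly"
  where "scal c p = Polynomial.smult [:c:] p"

lemma vector_space_scal: "vector_space (scal :: 'a::field \<Rightarrow> 'a poly poly \<Rightarrow> 'a poly poly)"
  by unfold_locales (simp_all add: scal_def smult_add_right smult_add_left[symmetric] mult.commute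
      flip: one_pCons)

definition var_x :: "'a::field poly poly"
  where "var_x = [:[:0, 1:]:]"

definition var_y :: "'a::field poly poly"
  where "var_y = [:0, 1:]"

definition partial_x :: "'a::field poly poly \<Rightarrow> 'a poly poly"
  where "partial_x f = map_poly pderiv f"

definition partial_y :: "'a::field poly poly \<Rightarrow> 'a poly poly"
  where "partial_y f = pderiv f"

definition linear_form :: "'a::field poly poly \<Rightarrow> bool"
  where "linear_form l \<longleftrightarrow> (\<exists>a b. l = scal a var_x + scal b var_y)"

text \<open>The forms are \<open>l 0, \<dots>, l (m - 1)\<close>; values of \<open>l\<close> at other indices are irrelevant.\<close>

definition central_arrangement :: "nat \<Rightarrow> (nat \<Rightarrow> 'a::field poly poly) \<Rightarrow> bool"
  where "central_arrangement m l \<longleftrightarrow>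
    (\<forall>i<m. linear_form (l i) \<and> l i \<noteq> 0) \<and>
    (\<forall>i<m. \<forall>j<m. i \<noteq> j \<longrightarrow> \<not> (\<exists>c. l i = scal c (l j)))"

definition arrangement_rank :: "nat \<Rightarrow> (nat \<Rightarrow> 'a::field poly poly) \<Rightarrow> nat"
  where "arrangement_rank m l = vector_space.dim scal (l ` {..<m})"

definition defining_poly :: "nat \<Rightarrow> (nat \<Rightarrow> 'a::field poly poly) \<Rightarrow> 'a poly poly"
  where "defining_poly m l = (\<Prod>i<m. l i)"

definition jacobian_ideal :: "'a::field poly poly \<Rightarrow> 'a poly poly set"
  where "jacobian_ideal f = genideal Kxy {partial_x f, partial_y f}"

text \<open>Here \<open>div\<close> is the exact division of the integral domain \<open>K[x,y]\<close>.\<close>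

definition quotient_ideal :: "nat \<Rightarrow> (nat \<Rightarrow> 'a::field poly poly) \<Rightarrow> 'a poly poly set"
  where "quotient_ideal m l = genideal Kxy ((\<lambda>i. defining_poly m l div l i) ` {..<m})"

text \<open>
  Powers of ideals are taken in the multiplicative monoid of ideals, so the zeroth power is
  the whole ring.
\<close>

definition reduction_at :: "('a, 'b) ring_scheme \<Rightarrow> 'a set \<Rightarrow> 'a set \<Rightarrow> nat \<Rightarrow> bool"
  where "reduction_at R J I k \<longleftrightarrow>
    I [^]\<^bsub>ideals_set R\<^esub> (k + 1) = ideal_prod R J (I [^]\<^bsub>ideals_set R\<^esub> k)"

definition is_reduction :: "('a, 'b) ring_scheme \<Rightarrow> 'a set \<Rightarrow> 'a set \<Rightarrow> bool"
  where "is_reduction R J I \<longleftrightarrow>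
    ideal J R \<and> ideal I R \<and> J \<subseteq> I \<and> (\<exists>k. reduction_at R J I k)"

text \<open>Only meaningful when \<open>J\<close> is a reduction of \<open>I\<close>.\<close>

definition reduction_number :: "('a, 'b) ring_scheme \<Rightarrow> 'a set \<Rightarrow> 'a set \<Rightarrow> nat"
  where "reduction_number R J I = (LEAST k. reduction_at R J I k)"

end

theory Submission
  imports Defs
begin

text \<open>
  Write \<open>l\<^sub>i = a\<^sub>i x + b\<^sub>i y\<close> and \<open>f\<^sub>i = f / l\<^sub>i\<close>, and let \<open>J\<close> and \<open>I\<close> be the ideals generated by
  the partial derivatives and by the cofactors \<open>f\<^sub>i\<close>. Since \<open>l\<^sub>i\<close> has constant partial derivatives, the
  product rule gives \<open>f\<^sub>x = \<Sum>\<^sub>i a\<^sub>i f\<^sub>i\<close> and \<open>f\<^sub>y = \<Sum>\<^sub>i b\<^sub>i f\<^sub>i\<close>; in particular \<open>J \<subseteq> I\<close>.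

  \<^bold>\<open>Why \<open>I\<^sup>2 = J I\<close>.\<close> For \<open>i \<noteq> j\<close> put \<open>G = f / (l\<^sub>i l\<^sub>j)\<close>. Then \<open>f\<^sub>i f\<^sub>j = f G\<close>, and Euler's relation
  \<open>m f = x f\<^sub>x + y f\<^sub>y\<close> turns this into \<open>m f\<^sub>i f\<^sub>j = f\<^sub>x (x G) + f\<^sub>y (y G)\<close>. Two non-proportional
  forms span \<open>x\<close> and \<open>y\<close>, so \<open>x G\<close> and \<open>y G\<close> are combinations of \<open>l\<^sub>i G = f\<^sub>j\<close> and \<open>l\<^sub>j G = f\<^sub>i\<close>
  and lie in \<open>I\<close>. As \<open>m\<close> is invertible in the field, \<open>f\<^sub>i f\<^sub>j \<in> J I\<close> (\<open>cofactor_mult_distinct\<close>).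
  The squares follow: expanding \<open>f\<^sub>x f\<^sub>i\<close> and \<open>f\<^sub>y f\<^sub>i\<close>, both in \<open>J I\<close>, all terms but \<open>a\<^sub>i f\<^sub>i\<^sup>2\<close> and
  \<open>b\<^sub>i f\<^sub>i\<^sup>2\<close> are of the kind just treated, and \<open>a\<^sub>i\<close>, \<open>b\<^sub>i\<close> are not both zero
  (\<open>cofactor_square\<close>).

  \<^bold>\<open>Why the reduction number is not \<open>0\<close>.\<close> That would mean \<open>I = J\<close>. Suppose
  \<open>f\<^sub>0 = p f\<^sub>x + q f\<^sub>y\<close> and restrict to the line \<open>l\<^sub>j = 0\<close>. There every cofactor except \<open>f\<^sub>j\<close>
  vanishes, while \<open>f\<^sub>j\<close> does not, so cancelling it leaves \<open>p a\<^sub>j + q b\<^sub>j = 1\<close> on the line if \<open>j = 0\<close> and \<open>= 0\<close>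
  otherwise. All these lines pass through the origin, so this is a system of linear equations
  for the two scalars \<open>p(0,0)\<close> and \<open>q(0,0)\<close>: the equations for \<open>j = 1, 2\<close> force both to vanish,
  which contradicts the one for \<open>j = 0\<close> (\<open>cofactor_not_in_J\<close>). This is where \<open>m \<ge> 3\<close> enters.
\<close>

section \<open>Ideals of a commutative ring type\<close>

lemma ring_of_type_algebra_simps [simp]:
  "carrier (ring_of_type_algebra :: 'r::comm_ring_1 ring) = UNIV"
  "\<one>\<^bsub>(ring_of_type_algebra :: 'r ring)\<^esub> = 1"
  "\<zero>\<^bsub>(ring_of_type_algebra :: 'r ring)\<^esub> = 0"
  "p \<otimes>\<^bsub>(ring_of_type_algebra :: 'r ring)\<^esub> q = p * q"
  "p \<oplus>\<^bsub>(ring_of_type_algebra :: 'r ring)\<^esub> q = p + q"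
  by (simp_all add: ring_of_type_algebra_def)

lemma ideal_of_type_iff:
  "ideal A (ring_of_type_algebra :: 'r::comm_ring_1 ring) \<longleftrightarrow>
    0 \<in> A \<and> (\<forall>p\<in>A. \<forall>q\<in>A. p + q \<in> A) \<and> (\<forall>p\<in>A. \<forall>r. r * p \<in> A)"
    (is "ideal A ?R \<longleftrightarrow> ?closed")
proof
  assume "ideal A ?R"
  then interpret ideal A ?R .
  show ?closed
    using additive_subgroup.zero_closed [OF additive_subgroup_axioms]
      additive_subgroup.a_closed [OF additive_subgroup_axioms] I_l_closed by simp
next
  assume closed: ?closed
  interpret cring ?R ..
  have neg: "inv\<^bsub>add_monoid ?R\<^esub> p = - p" for p :: 'r
    by (rule comm_monoid.comm_inv_char [OF a_comm_monoid]) simp_all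
  have "inv\<^bsub>add_monoid ?R\<^esub> p \<in> A" if "p \<in> A" for p
    unfolding neg using closed that by (metis mult_minus1)
  with closed have "subgroup A (add_monoid ?R)"
    by (intro subgroup.intro) simp_all
  with closed show "ideal A ?R"
    by (intro idealI ring_axioms) (simp_all add: mult.commute)
qed

lemma genideal_of_type_ideal:
  "ideal (genideal ring_of_type_algebra S) (ring_of_type_algebra :: 'r::comm_ring_1 ring)"
  by (rule ring.genideal_ideal [OF ring_from_type_algebra]) simp

lemma genideal_of_type_incl:
  "S \<subseteq> genideal (ring_of_type_algebra :: 'r::comm_ring_1 ring) S"
  by (rule ring.genideal_self [OF ring_from_type_algebra]) simp

lemma genideal_of_type_least:
  "ideal A (ring_of_type_algebra :: 'r::comm_ring_1 ring) \<Longrightarrow> S \<subseteq> A \<Longrightarrow>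
    genideal ring_of_type_algebra S \<subseteq> A"
  by (rule ring.genideal_minimal [OF ring_from_type_algebra])

lemma ideal_of_type_sum:
  assumes "ideal A (ring_of_type_algebra :: 'r::comm_ring_1 ring)"
    and "\<And>i. i \<in> N \<Longrightarrow> g i \<in> A"
  shows "sum g N \<in> A"
  using assms(2)
  by (induction N rule: infinite_finite_induct) (use assms(1) in \<open>auto simp: ideal_of_type_iff\<close>)

lemma ideal_of_type_diff:
  assumes "ideal A (ring_of_type_algebra :: 'r::comm_ring_1 ring)" "p \<in> A" "q \<in> A"
  shows "p - q \<in> A"
proof -
  have "p + (- 1) * q \<in> A"
    using assms unfolding ideal_of_type_iff by blast
  then show ?thesis
    by simp
qed

lemma genideal_of_type_pair:
  assumes "r \<in> genideal (ring_of_type_algebra :: 'r::comm_ring_1 ring) {g, h}"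
  obtains p q where "r = p * g + q * h"
proof -
  let ?A = "{r. \<exists>p q. r = p * g + q * h}"
  have "0 = 0 * g + 0 * h"
    by simp
  moreover have "(p * g + q * h) + (p' * g + q' * h) = (p + p') * g + (q + q') * h" for p q p' q'
    by (simp add: algebra_simps)
  moreover have "s * (p * g + q * h) = (s * p) * g + (s * q) * h" for s p q
    by (simp add: algebra_simps)
  ultimately have "ideal ?A (ring_of_type_algebra :: 'r ring)"
    unfolding ideal_of_type_iff by fast
  moreover have "g = 1 * g + 0 * h" "h = 0 * g + 1 * h"
    by simp_all
  then have "{g, h} \<subseteq> ?A"
    by blast
  ultimately show ?thesis
    using genideal_of_type_least assms that by blast
qed

lemma ideal_prod_of_type_ideal:
  assumes "ideal A (ring_of_type_algebra :: 'r::comm_ring_1 ring)"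
    and "ideal B (ring_of_type_algebra :: 'r ring)"
  shows "ideal (ideal_prod ring_of_type_algebra A B) (ring_of_type_algebra :: 'r ring)"
  using assms by (rule ring.ideal_prod_is_ideal [OF ring_from_type_algebra])

lemma mult_in_ideal_prod:
  "p \<in> A \<Longrightarrow> q \<in> B \<Longrightarrow> p * q \<in> ideal_prod (ring_of_type_algebra :: 'r::comm_ring_1 ring) A B"
  using ideal_prod.prod [of p A q B "ring_of_type_algebra :: 'r ring"] by simp

text \<open>
  A colon ideal \<open>{r. r * t \<in> A}\<close> that contains generators contains all they generate; applied to
  one factor and then to the other, this reduces a product of ideals to products of generators.
\<close>

lemma ideal_prod_genideal_subset:
  assumes A: "ideal A (ring_of_type_algebra :: 'r::comm_ring_1 ring)"
    and gens: "\<And>s t. s \<in> S \<Longrightarrow> t \<in> T \<Longrightarrow> s * t \<in> A"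
  shows "ideal_prod (ring_of_type_algebra :: 'r ring)
    (genideal ring_of_type_algebra S) (genideal ring_of_type_algebra T) \<subseteq> A"
proof
  have colon: "ideal {r. r * t \<in> A} (ring_of_type_algebra :: 'r ring)" for t
    using A by (auto simp: ideal_of_type_iff ring_distribs mult.assoc)
  have "s * t \<in> A" if "s \<in> genideal ring_of_type_algebra S" "t \<in> T" for s t
    using genideal_of_type_least [OF colon [of t], of S] gens that by blast
  then have both: "s * t \<in> A"
    if "s \<in> genideal ring_of_type_algebra S" "t \<in> genideal ring_of_type_algebra T" for s t
    using genideal_of_type_least [OF colon [of s], of T] that by (fastforce simp: mult.commute)
  fix r
  assume "r \<in> ideal_prod (ring_of_type_algebra :: 'r ring)
    (genideal ring_of_type_algebra S) (genideal ring_of_type_algebra T)"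
  then show "r \<in> A"
    using A by induction (auto simp: both ideal_of_type_iff)
qed

lemma ideal_prod_of_type_one:
  assumes "ideal A (ring_of_type_algebra :: 'r::comm_ring_1 ring)"
  shows "ideal_prod (ring_of_type_algebra :: 'r ring) A UNIV = A"
    and "ideal_prod (ring_of_type_algebra :: 'r ring) UNIV A = A"
proof -
  interpret cring "ring_of_type_algebra :: 'r ring" ..
  show right: "ideal_prod (ring_of_type_algebra :: 'r ring) A UNIV = A"
    using ideal_prod_one [OF assms] by simp
  then show "ideal_prod (ring_of_type_algebra :: 'r ring) UNIV A = A"
    using ideal_prod_commute [OF oneideal assms] by simp
qed

text \<open>
  The two exponents that decide whether the reduction number is one, with the powers of ideals
  spelled out.
\<close>

lemma reduction_at_of_type:
  assumes "ideal J (ring_of_type_algebra :: 'r::comm_ring_1 ring)"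
    and "ideal I (ring_of_type_algebra :: 'r ring)"
  shows "reduction_at (ring_of_type_algebra :: 'r ring) J I 0 \<longleftrightarrow> I = J"
    and "reduction_at (ring_of_type_algebra :: 'r ring) J I 1 \<longleftrightarrow>
      ideal_prod (ring_of_type_algebra :: 'r ring) I I = ideal_prod ring_of_type_algebra J I"
  by (simp_all add: reduction_at_def nat_pow_def ideals_set_def numeral_2_eq_2
      ideal_prod_of_type_one assms)

section \<open>Polynomials in two variables\<close>

lemma scal_mult: "scal c p = [:[:c:]:] * p"
  by (simp add: scal_def)

lemma linear_form_coords:
  "scal a var_x + scal b var_y = [:[:0, a:], [:b:]:]"
  by (simp add: scal_def var_x_def var_y_def)

lemma partial_x_mult: "partial_x (p * q) = partial_x p * q + p * partial_x q"
proof (rule poly_eqI)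
  fix n
  have "pderiv (\<Sum>i\<in>N. g i) = (\<Sum>i\<in>N. pderiv (g i))"
    for N :: "nat set" and g :: "nat \<Rightarrow> 'a poly"
    by (induction N rule: infinite_finite_induct) (simp_all add: pderiv_add)
  moreover have "pderiv (g * h) = pderiv g * h + g * pderiv h" for g h :: "'a poly"
    by (simp add: pderiv_mult mult.commute)
  ultimately show "coeff (partial_x (p * q)) n = coeff (partial_x p * q + p * partial_x q) n"
    by (simp add: partial_x_def coeff_map_poly coeff_mult sum.distrib)
qed

lemma partial_x_prod:
  "partial_x (\<Prod>i\<in>N. g i) = (\<Sum>i\<in>N. (\<Prod>j\<in>N - {i}. g j) * partial_x (g i))"
  if "finite N"
  using that
proof induction
  case empty
  then show ?case
    by (simp add: partial_x_def map_poly_1)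
next
  case (insert n N)
  have "(\<Prod>j\<in>insert n N - {i}. g j) = g n * (\<Prod>j\<in>N - {i}. g j)" if "i \<in> N" for i
  proof -
    have "insert n N - {i} = insert n (N - {i})"
      using insert that by auto
    then show ?thesis
      using insert by simp
  qed
  then have "(\<Sum>i\<in>N. (\<Prod>j\<in>insert n N - {i}. g j) * partial_x (g i)) =
      g n * (\<Sum>i\<in>N. (\<Prod>j\<in>N - {i}. g j) * partial_x (g i))"
    by (simp add: sum_distrib_left mult.assoc)
  with insert show ?case
    by (simp add: partial_x_mult mult.commute)
qed

text \<open>
  The restriction of \<open>p\<close> along \<open>t \<mapsto> (u t, v t)\<close>, as a polynomial in \<open>t\<close>. Keeping \<open>t\<close> as an
  indeterminate puts the values in an integral domain, where a factor that does not vanish on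
  the line can be cancelled before \<open>t = 0\<close> is substituted.
\<close>

definition restrict_line :: "'a::field \<Rightarrow> 'a \<Rightarrow> 'a poly poly \<Rightarrow> 'a poly"
  where "restrict_line u v p = poly (map_poly (\<lambda>c. pcompose c [:0, u:]) p) [:0, v:]"

lemma restrict_line_pCons:
  "restrict_line u v (pCons c p) = pcompose c [:0, u:] + [:0, v:] * restrict_line u v p"
  by (simp add: restrict_line_def map_poly_pCons)

lemma restrict_line_0 [simp]: "restrict_line u v 0 = 0"
  by (simp add: restrict_line_def)

lemma restrict_line_add: "restrict_line u v (p + q) = restrict_line u v p + restrict_line u v q"
proof -
  have "map_poly (\<lambda>c. pcompose c [:0, u:]) (p + q) =
      map_poly (\<lambda>c. pcompose c [:0, u:]) p + map_poly (\<lambda>c. pcompose c [:0, u:]) q"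
    by (rule poly_eqI) (simp add: coeff_map_poly pcompose_add)
  then show ?thesis
    by (simp add: restrict_line_def)
qed

lemma restrict_line_smult:
  "restrict_line u v (Polynomial.smult c p) = pcompose c [:0, u:] * restrict_line u v p"
  by (simp add: restrict_line_def map_poly_smult pcompose_mult)

lemma restrict_line_mult: "restrict_line u v (p * q) = restrict_line u v p * restrict_line u v q"
  by (induction p)
    (simp_all add: restrict_line_add restrict_line_smult restrict_line_pCons algebra_simps)

lemma restrict_line_scal: "restrict_line u v (scal c p) = [:c:] * restrict_line u v p"
  by (simp add: scal_def restrict_line_smult)

lemma restrict_line_sum: "restrict_line u v (sum g N) = (\<Sum>i\<in>N. restrict_line u v (g i))"
  by (induction N rule: infinite_finite_induct) (simp_all add: restrict_line_add)

lemma restrict_line_prod: "restrict_line u v (prod g N) = (\<Prod>i\<in>N. restrict_line u v (g i))"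
  by (induction N rule: infinite_finite_induct)
    (simp_all add: restrict_line_mult one_pCons restrict_line_pCons)

text \<open>All lines meet at the origin: the value at \<open>t = 0\<close> does not depend on \<open>u\<close> and \<open>v\<close>.\<close>

lemma poly_restrict_line_0: "poly (restrict_line u v p) 0 = poly (poly p 0) 0"
  by (cases p) (simp add: restrict_line_pCons poly_pcompose)

section \<open>The cofactors of an arrangement\<close>

text \<open>
  A central arrangement in the plane with coordinates chosen for its forms; non-proportionality
  becomes the non-vanishing of the \<open>2 \<times> 2\<close> minors.
\<close>

locale line_arrangement =
  fixes m :: nat and l :: "nat \<Rightarrow> 'a::field poly poly" and a b :: "nat \<Rightarrow> 'a"
  assumes form: "i < m \<Longrightarrow> l i = scal (a i) var_x + scal (b i) var_y"
    and det_nonzero: "i < m \<Longrightarrow> j < m \<Longrightarrow> i \<noteq> j \<Longrightarrow> a i * b j - a j * b i \<noteq> 0"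
    and at_least_two: "2 \<le> m"
begin

abbreviation f where "f \<equiv> defining_poly m l"

definition cofactor :: "nat \<Rightarrow> 'a poly poly"
  where "cofactor i = (\<Prod>j\<in>{..<m} - {i}. l j)"

lemma coords_nonzero:
  assumes "i < m"
  shows "a i \<noteq> 0 \<or> b i \<noteq> 0"
proof -
  obtain j where "j < m" "i \<noteq> j"
    using that [of 0] that [of 1] at_least_two by linarith
  then show ?thesis
    using det_nonzero [OF assms] by auto
qed

lemma form_coords: "i < m \<Longrightarrow> l i = [:[:0, a i:], [:b i:]:]"
  by (simp only: form linear_form_coords)

lemma form_nonzero: "i < m \<Longrightarrow> l i \<noteq> 0"
  using coords_nonzero by (auto simp: form_coords)

lemma f_eq_form_cofactor: "i < m \<Longrightarrow> f = l i * cofactor i"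
  unfolding defining_poly_def cofactor_def by (rule prod.remove) auto

lemma f_div_form: "i < m \<Longrightarrow> f div l i = cofactor i"
  using f_eq_form_cofactor [of i] form_nonzero [of i] by simp

lemma quotient_ideal_cofactors: "quotient_ideal m l = genideal Kxy (cofactor ` {..<m})"
proof -
  have "(\<lambda>i. f div l i) ` {..<m} = cofactor ` {..<m}"
    by (intro image_cong refl) (simp add: f_div_form)
  then show ?thesis
    by (simp add: quotient_ideal_def)
qed

lemma partial_x_f: "partial_x f = (\<Sum>i<m. scal (a i) (cofactor i))"
proof -
  have "partial_x (l i) = [:[:a i:]:]" if "i < m" for i
    using that by (simp add: form_coords partial_x_def map_poly_pCons pderiv_pCons)
  then show ?thesis
    unfolding defining_poly_def
    by (subst partial_x_prod) (simp_all add: cofactor_def scal_mult mult.commute)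
qed

lemma partial_y_f: "partial_y f = (\<Sum>i<m. scal (b i) (cofactor i))"
proof -
  have "pderiv (l i) = [:[:b i:]:]" if "i < m" for i
    using that by (simp add: form_coords pderiv_pCons)
  then show ?thesis
    unfolding defining_poly_def partial_y_def
    by (subst pderiv_prod) (simp_all add: cofactor_def scal_mult mult.commute)
qed

lemma Euler: "var_x * partial_x f + var_y * partial_y f = scal (of_nat m) f"
proof -
  have "var_x * partial_x f + var_y * partial_y f = (\<Sum>i<m. l i * cofactor i)"
    by (simp add: partial_x_f partial_y_f sum_distrib_left form scal_mult algebra_simps
        flip: sum.distrib)
  also have "\<dots> = (\<Sum>i<m. f)"
    by (intro sum.cong) (simp_all add: f_eq_form_cofactor)
  also have "\<dots> = scal (of_nat m) f"
    by (simp add: scal_def of_nat_poly)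
  finally show ?thesis .
qed

abbreviation J where "J \<equiv> jacobian_ideal f"
abbreviation I where "I \<equiv> quotient_ideal m l"
abbreviation JI where "JI \<equiv> ideal_prod Kxy J I"

lemma ideal_J: "ideal J Kxy"
  unfolding jacobian_ideal_def by (rule genideal_of_type_ideal)

lemma ideal_I: "ideal I Kxy"
  unfolding quotient_ideal_def by (rule genideal_of_type_ideal)

lemma ideal_JI: "ideal JI Kxy"
  by (rule ideal_prod_of_type_ideal [OF ideal_J ideal_I])

lemma partial_in_J: "partial_x f \<in> J" "partial_y f \<in> J"
  using genideal_of_type_incl [of "{partial_x f, partial_y f}"] by (simp_all add: jacobian_ideal_def)

lemma cofactor_in_I: "i < m \<Longrightarrow> cofactor i \<in> I"
  using genideal_of_type_incl [of "cofactor ` {..<m}"] by (auto simp: quotient_ideal_cofactors)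

lemma ideal_scal: "ideal A (Kxy :: 'a poly poly ring) \<Longrightarrow> p \<in> A \<Longrightarrow> scal c p \<in> A"
  by (simp only: ideal_of_type_iff scal_mult)

lemma ideal_scal_iff:
  assumes "ideal A (Kxy :: 'a poly poly ring)" "c \<noteq> 0"
  shows "scal c p \<in> A \<longleftrightarrow> p \<in> A"
proof
  assume "scal c p \<in> A"
  then have "scal (inverse c) (scal c p) \<in> A"
    by (rule ideal_scal [OF assms(1)])
  then show "p \<in> A"
    using assms(2) by (simp add: scal_def flip: one_pCons)
qed (rule ideal_scal [OF assms(1)])

lemma J_subset_I: "J \<subseteq> I"
proof -
  have "partial_x f \<in> I" "partial_y f \<in> I"
    unfolding partial_x_f partial_y_f
    by (intro ideal_of_type_sum [OF ideal_I] ideal_scal [OF ideal_I] cofactor_in_I; simp)+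
  then show ?thesis
    unfolding jacobian_ideal_def by (intro genideal_of_type_least ideal_I) simp
qed

text \<open>
  With \<open>G = f / (l\<^sub>i l\<^sub>j)\<close> the product is \<open>f G\<close>. Euler's relation writes \<open>m f\<close> in terms of the partial
  derivatives, and the remaining factors \<open>x G\<close> and \<open>y G\<close> lie in \<open>I\<close> because \<open>x\<close> and \<open>y\<close> are
  combinations of \<open>l\<^sub>i\<close> and \<open>l\<^sub>j\<close>.
\<close>

lemma cofactor_mult_distinct:
  assumes char: "\<not> CHAR('a) dvd m" and ij: "i < m" "j < m" "i \<noteq> j"
  shows "cofactor i * cofactor j \<in> JI"
proof -
  define G where "G = (\<Prod>k\<in>{..<m} - {i, j}. l k)"
  have "cofactor i = l j * G"
    unfolding cofactor_def G_def using ij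
    by (subst prod.remove [of _ j]) (simp_all flip: Diff_insert2)
  moreover have "cofactor j = l i * G"
    unfolding cofactor_def G_def using ij
    by (subst prod.remove [of _ i]) (simp_all flip: Diff_insert)
  moreover note f_eq_form_cofactor [OF ij(1)]
  ultimately have G: "cofactor i = l j * G" "cofactor j = l i * G" "f = l i * (l j * G)"
    by simp_all
  define d where "d = a i * b j - a j * b i"
  have d: "d \<noteq> 0"
    using det_nonzero ij by (simp add: d_def)
  \<comment> \<open>Cramer's rule for the two forms, here and for \<open>y\<close> below.\<close>
  have "scal d var_x = scal (b j) (l i) - scal (b i) (l j)"
    using ij by (simp add: form_coords scal_def d_def var_x_def algebra_simps)
  then have "scal d (var_x * G) = scal (b j) (cofactor j) - scal (b i) (cofactor i)"
    by (simp add: G scal_mult left_diff_distrib flip: mult.assoc del: mult_pCons_left)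
  also have "\<dots> \<in> I"
    using ij by (intro ideal_of_type_diff ideal_I ideal_scal cofactor_in_I)
  finally have xG: "var_x * G \<in> I"
    using ideal_scal_iff [OF ideal_I d] by blast
  have "scal d var_y = scal (a i) (l j) - scal (a j) (l i)"
    using ij by (simp add: form_coords scal_def d_def var_y_def algebra_simps)
  then have "scal d (var_y * G) = scal (a i) (cofactor i) - scal (a j) (cofactor j)"
    by (simp add: G scal_mult left_diff_distrib flip: mult.assoc del: mult_pCons_left)
  also have "\<dots> \<in> I"
    using ij by (intro ideal_of_type_diff ideal_I ideal_scal cofactor_in_I)
  finally have yG: "var_y * G \<in> I"
    using ideal_scal_iff [OF ideal_I d] by blast
  have "scal (of_nat m) (cofactor i * cofactor j) = scal (of_nat m) f * G"
    by (simp add: G scal_mult algebra_simps)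
  also have "\<dots> = partial_x f * (var_x * G) + partial_y f * (var_y * G)"
    by (simp add: algebra_simps flip: Euler)
  also have "\<dots> \<in> JI"
    using ideal_JI xG yG partial_in_J
    by (auto simp: ideal_of_type_iff intro: mult_in_ideal_prod)
  finally show ?thesis
    using ideal_scal_iff [OF ideal_JI] char by (simp add: of_nat_eq_0_iff_char_dvd)
qed

text \<open>
  An element \<open>\<Sum>\<^sub>j c\<^sub>j f\<^sub>j\<close> of \<open>J\<close> multiplied by \<open>f\<^sub>i\<close> is \<open>c\<^sub>i f\<^sub>i\<^sup>2\<close> up to products of distinct cofactors.
  The two partial derivatives provide \<open>c\<^sub>i = a\<^sub>i\<close> and \<open>c\<^sub>i = b\<^sub>i\<close>, one of which is a unit.
\<close>

lemma cofactor_square: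
  assumes char: "\<not> CHAR('a) dvd m" and i: "i < m"
  shows "cofactor i * cofactor i \<in> JI"
proof -
  have square: "scal (c i) (cofactor i * cofactor i) \<in> JI"
    if "(\<Sum>j<m. scal (c j) (cofactor j)) \<in> J" for c
  proof -
    let ?rest = "\<Sum>j\<in>{..<m} - {i}. scal (c j) (cofactor j * cofactor i)"
    have "?rest \<in> JI"
      by (intro ideal_of_type_sum ideal_scal ideal_JI cofactor_mult_distinct char i) auto
    moreover have "(\<Sum>j<m. scal (c j) (cofactor j)) * cofactor i \<in> JI"
      using that cofactor_in_I [OF i] by (rule mult_in_ideal_prod)
    moreover have "(\<Sum>j<m. scal (c j) (cofactor j)) * cofactor i =
        scal (c i) (cofactor i * cofactor i) + ?rest"
      using i by (simp add: sum.remove [of "{..<m}" i] scal_def sum_distrib_right distrib_right)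
    ultimately show ?thesis
      using ideal_of_type_diff [OF ideal_JI] by force
  qed
  have "scal (a i) (cofactor i * cofactor i) \<in> JI" "scal (b i) (cofactor i * cofactor i) \<in> JI"
    using square partial_in_J by (simp_all add: partial_x_f partial_y_f)
  then show ?thesis
    using coords_nonzero [OF i] ideal_scal_iff [OF ideal_JI] by blast
qed

lemma square_I:
  assumes "\<not> CHAR('a) dvd m"
  shows "ideal_prod Kxy I I = JI"
proof
  have "cofactor i * cofactor j \<in> JI" if "i < m" "j < m" for i j
    using cofactor_mult_distinct cofactor_square assms that by (cases "i = j") auto
  then have "ideal_prod Kxy (genideal Kxy (cofactor ` {..<m})) (genideal Kxy (cofactor ` {..<m}))
      \<subseteq> JI"
    by (intro ideal_prod_genideal_subset ideal_JI) auto
  then show "ideal_prod Kxy I I \<subseteq> JI"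
    by (simp add: quotient_ideal_cofactors)
  show "JI \<subseteq> ideal_prod Kxy I I"
  proof
    fix p assume "p \<in> JI"
    then show "p \<in> ideal_prod Kxy I I"
      by induction
        (use J_subset_I in \<open>auto intro: ideal_prod.intros simp del: ring_of_type_algebra_simps\<close>)
  qed
qed

text \<open>
  The direction \<open>(b\<^sub>j, - a\<^sub>j)\<close> spans the line \<open>l\<^sub>j = 0\<close>, and \<open>f\<^sub>j\<close> is the only cofactor without the
  factor \<open>l\<^sub>j\<close>. So restriction to this line isolates the \<open>j\<close>-th summand of \<open>f\<^sub>x\<close> and of \<open>f\<^sub>y\<close>.
\<close>

lemma cofactor_on_line:
  assumes "i < m" "j < m"
  shows "restrict_line (b j) (- a j) (cofactor i) = 0 \<longleftrightarrow> i \<noteq> j"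
proof -
  have "restrict_line (b j) (- a j) (l k) = [:0, a k * b j - a j * b k:]" if "k < m" for k
    using that
    by (simp add: form_coords restrict_line_pCons pcompose_pCons algebra_simps)
  then have "restrict_line (b j) (- a j) (l k) = 0 \<longleftrightarrow> k = j" if "k < m" for k
    using that det_nonzero [of k j] assms by auto
  then show ?thesis
    using assms by (auto simp: cofactor_def restrict_line_prod)
qed

text \<open>
  The restrictions of an equation \<open>f\<^sub>0 = p f\<^sub>x + q f\<^sub>y\<close> to three of the lines give three incompatible
  linear equations for the two constant terms of \<open>p\<close> and \<open>q\<close>.
\<close>

lemma cofactor_not_in_J:
  assumes m: "3 \<le> m"
  shows "cofactor 0 \<notin> J"
proof
  assume "cofactor 0 \<in> J"
  then obtain p q where pq: "cofactor 0 = p * partial_x f + q * partial_y f"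
    unfolding jacobian_ideal_def by (rule genideal_of_type_pair)
  define p0 q0 where "p0 = poly (poly p 0) 0" and "q0 = poly (poly q 0) 0"
  have origin: "p0 * a j + q0 * b j = (if j = 0 then 1 else 0)" if j: "j < m" for j
  proof -
    let ?r = "restrict_line (b j) (- a j)"
    have on_line: "?r (\<Sum>i<m. scal (c i) (cofactor i)) = [:c j:] * ?r (cofactor j)" for c
    proof -
      have "?r (\<Sum>i<m. scal (c i) (cofactor i)) = (\<Sum>i<m. [:c i:] * ?r (cofactor i))"
        by (simp add: restrict_line_sum restrict_line_scal)
      also have "\<dots> = (\<Sum>i\<in>{j}. [:c i:] * ?r (cofactor i))"
        using j by (intro sum.mono_neutral_right) (auto simp: cofactor_on_line)
      finally show ?thesis
        by simp
    qed
    have "(?r p * [:a j:] + ?r q * [:b j:]) * ?r (cofactor j) = ?r (cofactor 0)"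
      unfolding pq restrict_line_add restrict_line_mult partial_x_f partial_y_f on_line
      by (simp add: algebra_simps)
    also have "\<dots> = (if j = 0 then 1 else 0) * ?r (cofactor j)"
      using j cofactor_on_line [of 0 j] by auto
    finally have "?r p * [:a j:] + ?r q * [:b j:] = (if j = 0 then 1 else 0)"
      using j by (simp only: mult_right_cancel cofactor_on_line not_not simp_thms)
    then have "poly (?r p * [:a j:] + ?r q * [:b j:]) 0 = (if j = 0 then 1 else 0)"
      by simp
    then show ?thesis
      by (simp add: poly_restrict_line_0 p0_def q0_def mult.commute split: if_splits)
  qed
  have 1: "p0 * a 1 + q0 * b 1 = 0" and 2: "p0 * a 2 + q0 * b 2 = 0"
    and 0: "p0 * a 0 + q0 * b 0 = 1"
    using origin [of 0] origin [of 1] origin [of 2] m by simp_all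
  have "(a 1 * b 2 - a 2 * b 1) * p0 = b 2 * (p0 * a 1 + q0 * b 1) - b 1 * (p0 * a 2 + q0 * b 2)"
    "(a 1 * b 2 - a 2 * b 1) * q0 = a 1 * (p0 * a 2 + q0 * b 2) - a 2 * (p0 * a 1 + q0 * b 1)"
    by (simp_all add: algebra_simps)
  then have "(a 1 * b 2 - a 2 * b 1) * p0 = 0" "(a 1 * b 2 - a 2 * b 1) * q0 = 0"
    unfolding 1 2 by simp_all
  moreover have "a 1 * b 2 - a 2 * b 1 \<noteq> 0"
    using det_nonzero [of 1 2] m by simp
  ultimately show False
    using 0 by simp
qed

end

lemma central_arrangement_coords:
  assumes "central_arrangement m l" "2 \<le> m"
  obtains a b where "line_arrangement m l a b"
proof -
  have "\<forall>i. \<exists>a b. i < m \<longrightarrow> l i = scal a var_x + scal b var_y"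
    using assms(1) by (auto simp: central_arrangement_def linear_form_def)
  then obtain a b where form: "\<And>i. i < m \<Longrightarrow> l i = scal (a i) var_x + scal (b i) var_y"
    by metis
  have "a i * b j - a j * b i \<noteq> 0" if ij: "i < m" "j < m" "i \<noteq> j" for i j
  proof
    assume det: "a i * b j - a j * b i = 0"
    have "l j \<noteq> 0"
      using assms(1) ij by (simp add: central_arrangement_def)
    then have "a j \<noteq> 0 \<or> b j \<noteq> 0"
      using ij by (auto simp: form linear_form_coords)
    then have "\<exists>c. a i = c * a j \<and> b i = c * b j"
    proof
      assume "a j \<noteq> 0"
      then show ?thesis
        using det by (intro exI [of _ "a i / a j"]) (auto simp: field_simps)
    next
      assume "b j \<noteq> 0"
      then show ?thesis
        using det by (intro exI [of _ "b i / b j"]) (auto simp: field_simps)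
    qed
    then obtain c where "a i = c * a j" "b i = c * b j"
      by blast
    then have "l i = scal c (l j)"
      unfolding form [OF ij(1)] form [OF ij(2)] linear_form_coords by (simp add: scal_def)
    then show False
      using assms(1) ij by (auto simp: central_arrangement_def)
  qed
  with form assms(2) show ?thesis
    by (intro that line_arrangement.intro)
qed

theorem proposition2p3:
  fixes m :: nat and l :: "nat \<Rightarrow> 'a::field poly poly"
  assumes "m \<ge> 3"
    and "infinite (UNIV :: 'a set)"
    and "\<not> CHAR('a) dvd m"
    and "central_arrangement m l"
    and "arrangement_rank m l = 2"
  shows "is_reduction Kxy (jacobian_ideal (defining_poly m l)) (quotient_ideal m l) \<and>
    reduction_number Kxy (jacobian_ideal (defining_poly m l)) (quotient_ideal m l) = 1"
proof -
  from assms(1,4) obtain a b where "line_arrangement m l a b"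
    using central_arrangement_coords [of m l] by auto
  then interpret line_arrangement m l a b .
  have one: "reduction_at Kxy J I 1"
    using reduction_at_of_type [OF ideal_J ideal_I] square_I [OF assms(3)] by blast
  have "I \<noteq> J"
    using cofactor_in_I [of 0] cofactor_not_in_J assms(1) by auto
  then have zero: "\<not> reduction_at Kxy J I 0"
    using reduction_at_of_type [OF ideal_J ideal_I] by blast
  have "reduction_number Kxy J I = 1"
    unfolding reduction_number_def
  proof (rule Least_equality [where P = "reduction_at Kxy J I"])
    fix k assume "reduction_at Kxy J I k"
    with zero show "1 \<le> k"
      by (cases k) auto
  qed (rule one)
  with one show ?thesis
    using ideal_J ideal_I J_subset_I by (auto simp: is_reduction_def)
qed

end
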